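(* Let $k\ge2$. If $\tau\in\mathbb E_k$ and $m=|\tau|$, then $\|m\|_k\leq\|\tau\|$.
   Context: For $k\ge2$, $\mathbb E_k$ is the set of base $k$ terms of the exponential notation system $\mathcal E$: the least set containing the constant $0$ and closed under $\sigma,\tau\mapsto\sigma+\tau$ and $\tau\mapsto k^\tau$ (base-$k$ exponentiation is a unary operation). Terms are treated modulo associativity (but not commutativity) of $+$. The value $|\tau|\in\mathbb N$ is the natural number obtained by evaluating the term. The norm is $\|0\|=1$, $\|\sigma+\tau\|=1+\|\sigma\|+\|\tau\|$, $\|k^\tau\|=1+\|\tau\|$. Normal forms: $\mathrm{nf}_k(0)=0$; for $n>0$, let $r$ be the unique natural number with $k^r\le n<k^{r+1}$ and $b=n-k^r$, and set $\mathrm{nf}_k(n)=k^{\mathrm{nf}_k(r)}+\mathrm{nf}_k(b)$, where the summand $\mathrm{nf}_k(b)$ (and the addition) is omitted if $b=0$. For $n\in\mathbb N$, $\|n\|_k=\|\mathrm{nf}_k(n)\|$. *)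

theory Defs
  imports Main
begin

datatype raw_term = RZero | RPlus raw_term raw_term | RPow raw_term

text \<open>The congruence generated by associativity of addition.  Note that
  \<open>RZero\<close> is not a neutral element and addition is not commutative.\<close>

inductive assoc_eq :: "raw_term \<Rightarrow> raw_term \<Rightarrow> bool" where
  assoc: "assoc_eq (RPlus (RPlus s t) u) (RPlus s (RPlus t u))"
| refl: "assoc_eq t t"
| sym: "assoc_eq s t \<Longrightarrow> assoc_eq t s"
| trans: "assoc_eq s t \<Longrightarrow> assoc_eq t u \<Longrightarrow> assoc_eq s u"
| plus: "assoc_eq s s' \<Longrightarrow> assoc_eq t t' \<Longrightarrow> assoc_eq (RPlus s t) (RPlus s' t')"
| pow: "assoc_eq t t' \<Longrightarrow> assoc_eq (RPow t) (RPow t')"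

primrec raw_value :: "nat \<Rightarrow> raw_term \<Rightarrow> nat" where
  "raw_value k RZero = 0"
| "raw_value k (RPlus s t) = raw_value k s + raw_value k t"
| "raw_value k (RPow t) = k ^ raw_value k t"

primrec raw_norm :: "raw_term \<Rightarrow> nat" where
  "raw_norm RZero = 1"
| "raw_norm (RPlus s t) = 1 + raw_norm s + raw_norm t"
| "raw_norm (RPow t) = 1 + raw_norm t"

text \<open>The type \<open>exp_term\<close> represents the set of base \<open>k\<close> terms.  Since base \<open>k\<close>
  exponentiation is a unary function symbol, this set of terms is the same for all \<open>k\<close>; the base
  enters as a parameter of the evaluation function and of the normal form.\<close>

quotient_type exp_term = raw_term / assoc_eq
  by (intro equivpI reflpI sympI transpI) (blast intro: assoc_eq.intros)+

lift_definition tZero :: exp_term is RZero .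

lift_definition tPlus :: "exp_term \<Rightarrow> exp_term \<Rightarrow> exp_term" is RPlus
  by (rule assoc_eq.plus)

lift_definition tPow :: "exp_term \<Rightarrow> exp_term" is RPow
  by (rule assoc_eq.pow)

lift_definition tvalue :: "nat \<Rightarrow> exp_term \<Rightarrow> nat" is raw_value
proof -
  fix k s t
  assume "assoc_eq s t"
  then show "raw_value k s = raw_value k t"
    by induction simp_all
qed

lift_definition tnorm :: "exp_term \<Rightarrow> nat" is raw_norm
proof -
  fix s t
  assume "assoc_eq s t"
  then show "raw_norm s = raw_norm t"
    by induction simp_all
qed

lemma tPlus_assoc: "tPlus (tPlus s t) u = tPlus s (tPlus t u)"
  by transfer (rule assoc_eq.assoc)

lemma exp_term_induct [case_names Zero Plus Pow, induct type: exp_term]: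
  assumes "P tZero"
    and "\<And>s t. P s \<Longrightarrow> P t \<Longrightarrow> P (tPlus s t)"
    and "\<And>t. P t \<Longrightarrow> P (tPow t)"
  shows "P t"
  using assms
proof transfer
  fix P :: "raw_term \<Rightarrow> bool" and t
  assume "P RZero" "\<And>s t. P s \<Longrightarrow> P t \<Longrightarrow> P (RPlus s t)" "\<And>t. P t \<Longrightarrow> P (RPow t)"
  then show "P t" by (induction t) simp_all
qed

lemma tvalue_simps [simp]:
  "tvalue k tZero = 0"
  "tvalue k (tPlus s t) = tvalue k s + tvalue k t"
  "tvalue k (tPow t) = k ^ tvalue k t"
  by (transfer, simp)+

lemma tnorm_simps [simp]:
  "tnorm tZero = 1"
  "tnorm (tPlus s t) = 1 + tnorm s + tnorm t"
  "tnorm (tPow t) = 1 + tnorm t"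
  by (transfer, simp)+

definition lead_exp :: "nat \<Rightarrow> nat \<Rightarrow> nat" where
  "lead_exp k n = (THE r. k ^ r \<le> n \<and> n < k ^ (r + 1))"

lemma lead_exp_ex1:
  fixes k n :: nat
  assumes "2 \<le> k" "0 < n"
  shows "\<exists>!r. k ^ r \<le> n \<and> n < k ^ (r + 1)"
proof (rule ex_ex1I)
  show "\<exists>r. k ^ r \<le> n \<and> n < k ^ (r + 1)"
    using ex_power_ivl1[of k n] assms by auto
next
  fix r s
  assume r: "k ^ r \<le> n \<and> n < k ^ (r + 1)" and s: "k ^ s \<le> n \<and> n < k ^ (s + 1)"
  have "k ^ r < k ^ (s + 1)" "k ^ s < k ^ (r + 1)"
    using r s by (blast intro: le_less_trans)+
  then have "r < s + 1" "s < r + 1"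
    using assms(1) power_strict_increasing_iff[of k] by (simp_all del: power_Suc add: Suc_le_eq)
  then show "r = s" by simp
qed

lemma lead_exp:
  assumes "2 \<le> k" "0 < n"
  shows "k ^ lead_exp k n \<le> n" "n < k ^ (lead_exp k n + 1)"
  using theI'[OF lead_exp_ex1[OF assms]] unfolding lead_exp_def by auto

lemma lead_exp_less:
  assumes "2 \<le> k" "0 < n"
  shows "lead_exp k n < n"
proof -
  have "lead_exp k n < k ^ lead_exp k n"
    using assms(1) by (intro power_gt_expt) simp
  also have "\<dots> \<le> n" using assms by (rule lead_exp)
  finally show ?thesis .
qed

text \<open>For \<open>k < 2\<close> the recursion is not well-founded; there \<open>nf k n\<close> is set to \<open>tZero\<close>,
  a value without significance.\<close>

function nf :: "nat \<Rightarrow> nat \<Rightarrow> exp_term" where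
  "nf k n =
    (if n = 0 \<or> k < 2 then tZero
     else let r = lead_exp k n; b = n - k ^ r
          in if b = 0 then tPow (nf k r) else tPlus (tPow (nf k r)) (nf k b))"
  by pat_completeness auto
termination
  by (relation "measure snd") (auto simp: lead_exp_less)

declare nf.simps [simp del]

definition nat_norm :: "nat \<Rightarrow> nat \<Rightarrow> nat" where
  "nat_norm k n = tnorm (nf k n)"

end

theory Submission
  imports Defs
begin

text \<open>Call \<open>nat_norm k i + 2\<close> the weight of the exponent \<open>i\<close>: it is what a summand \<open>k\<^sup>i\<close> adds to
  the norm, namely the norm of its normal form and the plus sign before it. As the first summand
  has no plus sign, for \<open>n > 0\<close> the number \<open>nat_norm k n + 1\<close> is the digit sum of \<open>n\<close> in base
  \<open>k\<close>, every digit being multiplied by the weight of its position (\<open>digit_weight_nat_norm\<close>).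

  By induction on the term, the theorem reduces to \<open>nat_norm_add_le\<close>, the inequality
  \<open>nat_norm k (a + b) \<le> 1 + nat_norm k a + nat_norm k b\<close>, because the normal form of \<open>k\<^sup>n\<close> is a
  single power. Adding \<open>a\<close> and \<open>b\<close> digit by digit, a carry replaces \<open>k\<close> units in position \<open>i\<close> by
  one unit in position \<open>i + 1\<close>, so a weighted digit sum is subadditive as soon as the weight of
  \<open>i + 1\<close> is at most \<open>k\<close> times the weight of \<open>i\<close> (\<open>digit_weight_add_le\<close>). That condition is
  needed only for \<open>k\<^bsup>i+1\<^esup> \<le> a + b\<close>. For such \<open>i\<close> the sum \<open>i + 1\<close> is smaller than \<open>a + b\<close>,
  so induction on \<open>a + b\<close> gives \<open>nat_norm k (i + 1) \<le> 1 + nat_norm k i + nat_norm k 1\<close>. Since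
  \<open>nat_norm k 1 = 2\<close> and norms are positive, the weight of \<open>i + 1\<close> is then at most twice that of
  \<open>i\<close>.\<close>

text \<open>The weighted digit sum is defined from the lowest digit upwards, by shifting the weights.
  In this form carries and the induction for subadditivity are easy to follow; agreement with
  the recursion on the leading power, which produces normal forms, is
  \<open>digit_weight_lead_exp\<close>.\<close>

function digit_weight :: "nat \<Rightarrow> (nat \<Rightarrow> nat) \<Rightarrow> nat \<Rightarrow> nat" where
  "digit_weight k w n =
    (if n = 0 \<or> k < 2 then 0
     else (n mod k) * w 0 + digit_weight k (\<lambda>i. w (Suc i)) (n div k))"
  by pat_completeness auto
termination
  by (relation "measure (\<lambda>(k, w, n). n)") auto

declare digit_weight.simps [simp del]

lemma digit_weight_0 [simp]: "digit_weight k w 0 = 0"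
  by (simp add: digit_weight.simps)

lemma digit_weight_rec:
  assumes "2 \<le> k"
  shows "digit_weight k w n = (n mod k) * w 0 + digit_weight k (\<lambda>i. w (Suc i)) (n div k)"
  using assms by (cases "n = 0") (simp_all add: digit_weight.simps[of k w n])

lemma digit_weight_digit:
  assumes "2 \<le> k" "d < k"
  shows "digit_weight k w d = d * w 0"
  using assms by (simp add: digit_weight_rec[of k w d])

text \<open>The bound \<open>k\<^bsup>i+1\<^esup> \<le> a + b\<close> singles out the positions \<open>i + 1\<close> that can receive a carry in the
  addition. It passes to the shifted weights and the quotients by \<open>k\<close>, and it is what makes the
  lemma applicable when the carry condition on the weights is itself proved by induction.\<close>

lemma digit_weight_add_le:
  assumes "2 \<le> k" and "\<And>i. k ^ Suc i \<le> a + b \<Longrightarrow> w (Suc i) \<le> k * w i"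
  shows "digit_weight k w (a + b) \<le> digit_weight k w a + digit_weight k w b"
  using assms(2)
proof (induction "a + b" arbitrary: a b w rule: less_induct)
  case less
  define w' where "w' = (\<lambda>i. w (Suc i))"
  define x y a' b' where "x = a mod k" and "y = b mod k" and "a' = a div k" and "b' = b div k"
  have a: "a = k * a' + x" and b: "b = k * b' + y"
    by (simp_all add: x_def y_def a'_def b'_def)
  have xy: "x < k" "y < k" using \<open>2 \<le> k\<close> by (simp_all add: x_def y_def)
  have rec: "digit_weight k w n = (n mod k) * w 0 + digit_weight k w' (n div k)" for n
    unfolding w'_def using \<open>2 \<le> k\<close> by (rule digit_weight_rec)
  have divmod: "(k * q + z) mod k = z" "(k * q + z) div k = q" if "z < k" for q z
    using that by simp_all
  have split: "digit_weight k w a + digit_weight k w b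
      = (x + y) * w 0 + (digit_weight k w' a' + digit_weight k w' b')"
    by (simp add: rec[of a] rec[of b] x_def y_def a'_def b'_def algebra_simps)
  have IH: "digit_weight k w' (c + d) \<le> digit_weight k w' c + digit_weight k w' d"
    if "k * (c + d) \<le> a + b" for c d
  proof (cases "c + d = 0")
    case False
    then have "c + d < k * (c + d)" using \<open>2 \<le> k\<close> by simp
    then have "c + d < a + b" using that by linarith
    moreover have "w' (Suc i) \<le> k * w' i" if i: "k ^ Suc i \<le> c + d" for i
    proof -
      have "k ^ Suc (Suc i) \<le> k * (c + d)" using mult_le_mono2[OF i, of k] by simp
      also have "\<dots> \<le> a + b" by fact
      finally show ?thesis unfolding w'_def by (rule less.prems)
    qed
    ultimately show ?thesis by (rule less.hyps)
  qed simp
  have IH1: "digit_weight k w' (a' + b') \<le> digit_weight k w' a' + digit_weight k w' b'"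
    by (rule IH) (simp add: a b algebra_simps)
  show ?case
  proof (cases "x + y < k")
    case True
    have eq: "a + b = k * (a' + b') + (x + y)" by (simp add: a b algebra_simps)
    have "(a + b) mod k = x + y" "(a + b) div k = a' + b'"
      unfolding eq using True by (rule divmod)+
    then show ?thesis using IH1 by (simp add: rec[of "a + b"] split)
  next
    case False
    define z where "z = x + y - k"
    have z: "x + y = k + z" "z < k" using False xy by (simp_all add: z_def)
    have eq: "a + b = k * (a' + b' + 1) + z" using z by (simp add: a b algebra_simps)
    have "(a + b) mod k = z" "(a + b) div k = a' + b' + 1"
      unfolding eq using z(2) by (rule divmod)+
    then have "digit_weight k w (a + b) = z * w 0 + digit_weight k w' (a' + b' + 1)"
      by (simp add: rec[of "a + b"])
    also have "digit_weight k w' (a' + b' + 1)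
        \<le> digit_weight k w' (a' + b') + digit_weight k w' 1"
      by (rule IH) (simp add: eq)
    also have "digit_weight k w' 1 = w 1"
      using \<open>2 \<le> k\<close> by (simp add: digit_weight_digit w'_def)
    also have "w 1 \<le> k * w 0"
      using less.prems[of 0] by (simp add: eq)
    finally show ?thesis using IH1 by (simp add: split z(1) algebra_simps)
  qed
qed

lemma lead_exp_eqI:
  assumes "2 \<le> k" "k ^ r \<le> n" "n < k ^ Suc r"
  shows "lead_exp k n = r"
proof -
  have "0 < n" using assms(1,2) by (cases n) simp_all
  from the1_equality[OF lead_exp_ex1[OF assms(1) this]] show ?thesis
    using assms(2,3) unfolding lead_exp_def by simp
qed

lemma digit_weight_remove_power:
  assumes "2 \<le> k" "k ^ r \<le> n" "n < k ^ Suc r"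
  shows "digit_weight k w n = w r + digit_weight k w (n - k ^ r)"
  using assms(2,3)
proof (induction r arbitrary: n w)
  case 0
  then obtain d where "n = Suc d" "Suc d < k" by (cases n) simp_all
  then show ?case using assms(1) by (simp add: digit_weight_digit)
next
  case (Suc r)
  let ?w' = "\<lambda>i. w (Suc i)"
  have "k ^ r \<le> n div k" "n div k < k ^ Suc r"
    using Suc.prems assms(1) by (simp_all add: less_eq_div_iff_mult_less_eq div_less_iff_less_mult mult.commute)
  then have "digit_weight k ?w' (n div k) = w (Suc r) + digit_weight k ?w' (n div k - k ^ r)"
    by (rule Suc.IH)
  moreover obtain c where c: "n = c + k ^ r * k"
    using Suc.prems(1) by (metis le_add_diff_inverse2 power_Suc2)
  then have "n div k - k ^ r = (n - k ^ Suc r) div k" "n mod k = (n - k ^ Suc r) mod k"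
    using assms(1) by (simp_all add: mult.commute)
  ultimately show ?case
    using digit_weight_rec[OF assms(1), of w n] digit_weight_rec[OF assms(1), of w "n - k ^ Suc r"]
    by simp
qed

lemma digit_weight_lead_exp:
  assumes "2 \<le> k" "0 < n"
  shows "digit_weight k w n = w (lead_exp k n) + digit_weight k w (n - k ^ lead_exp k n)"
  using digit_weight_remove_power[of k "lead_exp k n" n w] lead_exp[OF assms] assms(1) by simp

lemma nat_norm_0 [simp]: "nat_norm k 0 = 1"
  by (simp add: nat_norm_def nf.simps)

lemma nat_norm_rec:
  assumes "2 \<le> k" "0 < n"
  shows "nat_norm k n = (let r = lead_exp k n; b = n - k ^ r in
    if b = 0 then 1 + nat_norm k r else 2 + nat_norm k r + nat_norm k b)"
  using assms by (simp add: nat_norm_def nf.simps[of k n] Let_def)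

lemma nat_norm_power:
  assumes "2 \<le> k"
  shows "nat_norm k (k ^ n) = 1 + nat_norm k n"
proof -
  have "lead_exp k (k ^ n) = n" using assms by (intro lead_exp_eqI) simp_all
  then show ?thesis using assms by (simp add: nat_norm_rec)
qed

lemma nat_norm_pos: "0 < nat_norm k n"
proof -
  have "0 < tnorm t" for t by (induction t) simp_all
  then show ?thesis by (simp add: nat_norm_def)
qed

text \<open>Every summand \<open>k\<^sup>r\<close> of the normal form has norm \<open>nat_norm k r + 1\<close>, and there is one plus
  sign less than there are summands. Zero is excluded because its normal form has norm 1 but no
  power as a summand.\<close>

lemma digit_weight_nat_norm:
  assumes "2 \<le> k" "0 < n"
  shows "digit_weight k (\<lambda>i. nat_norm k i + 2) n = nat_norm k n + 1"
  using assms(2)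
proof (induction n rule: less_induct)
  case (less n)
  define b where "b = n - k ^ lead_exp k n"
  have "b < n" using less.prems assms(1) by (simp add: b_def)
  then have "0 < b \<Longrightarrow> digit_weight k (\<lambda>i. nat_norm k i + 2) b = nat_norm k b + 1"
    by (rule less.IH)
  then show ?case
    using digit_weight_lead_exp[OF assms(1) less.prems, of "\<lambda>i. nat_norm k i + 2"]
      nat_norm_rec[OF assms(1) less.prems]
    unfolding b_def[symmetric] Let_def by (cases "b = 0") simp_all
qed

text \<open>The induction is needed for the weights: they satisfy the carry condition by the
  inequality for the sums \<open>i + 1\<close> of an exponent and \<open>1\<close>, which are smaller than \<open>a + b\<close>.\<close>

lemma nat_norm_add_le:
  assumes "2 \<le> k"
  shows "nat_norm k (a + b) \<le> 1 + nat_norm k a + nat_norm k b"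
proof (induction "a + b" arbitrary: a b rule: less_induct)
  case less
  let ?w = "\<lambda>i. nat_norm k i + 2"
  have carry: "?w (Suc i) \<le> k * ?w i" if "k ^ Suc i \<le> a + b" for i
  proof -
    have "Suc i < k ^ Suc i" using assms by (intro power_gt_expt) simp
    then have "i + 1 < a + b" using that by linarith
    then have "nat_norm k (i + 1) \<le> 1 + nat_norm k i + nat_norm k 1" by (rule less.hyps)
    moreover have "nat_norm k 1 = 2" using nat_norm_power[OF assms, of 0] by simp
    ultimately have "?w (Suc i) \<le> 2 * ?w i" using nat_norm_pos[of k i] by simp
    also have "\<dots> \<le> k * ?w i" using assms by (rule mult_le_mono1)
    finally show ?thesis .
  qed
  show ?case
  proof (cases "a = 0 \<or> b = 0")
    case False
    then have "0 < a" "0 < b" "0 < a + b" by simp_all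
    from this[THEN digit_weight_nat_norm[OF assms]] show ?thesis
      using digit_weight_add_le[of k a b ?w, OF assms carry] by linarith
  qed auto
qed

theorem theorem5p4:
  fixes k m :: nat and \<tau> :: exp_term
  assumes "k \<ge> 2" and "m = tvalue k \<tau>"
  shows "nat_norm k m \<le> tnorm \<tau>"
  unfolding assms(2)
proof (induction \<tau>)
  case (Plus s t)
  then show ?case using nat_norm_add_le[OF assms(1), of "tvalue k s" "tvalue k t"] by simp
qed (simp_all add: nat_norm_power[OF assms(1)])

end
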